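(* Let $\zeta:A^*\to A^*$ be a non-erasing substitution on a finite alphabet $A$ such that the incidence matrix $M_\zeta$ is in PB-Frobenius form. Then for any $n\ge 1$ the incidence matrix $M_{\zeta_n}$ of the level $n$ blow-up substitution $\zeta_n$ is again in PB-Frobenius form (with respect to a suitable ordering of the letters of the alphabet $A_n$).
   Context: A substitution $\zeta$ on a finite alphabet $A=\{a_1,\dots,a_m\}$ assigns to each letter a word in the free monoid $A^*$ and extends to a monoid endomorphism of $A^*$; it is non-erasing if no $\zeta(a_i)$ is the empty word. Its incidence matrix $M_\zeta$ has as $(i,j)$ entry the number of occurrences of $a_i$ in $\zeta(a_j)$. The language $\mathcal{L}_\zeta$ is the set of all factors (contiguous subwords) of the words $\zeta^k(a)$, $a\in A$, $k\ge 0$. For $n\ge 1$ let $A_n$ be the set of words of length $n$ in $\mathcal{L}_\zeta$, considered as a new alphabet. The level $n$ blow-up substitution $\zeta_n$ on $A_n$ is defined as follows: for $w=a_1a_2\dots a_n\in A_n$ (here $a_1,\dots,a_n$ denote the letters of $w$) write $\zeta(w)=x_1x_2\dots x_{|\zeta(w)|}$ with $x_i\in A$ and set $$\zeta_n(w)=(x_1\dots x_n)(x_2\dots x_{n+1})\cdots(x_{|\zeta(a_1)|}\dots x_{|\zeta(a_1)|+n-1}),$$ i.e. the ordered list of the first $|\zeta(a_1)|$ factors of length $n$ of $\zeta(w)$. A non-negative integer square matrix $N$ is primitive if $N^k$ has only positive entries for some $k\ge1$; it is power bounded (PB) if the entries of $N^t$ are uniformly bounded for all $t\ge 1$. A non-negative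 integer square matrix is in PB-Frobenius form if it admits a block decomposition with square diagonal blocks for which it is a lower triangular block matrix and every diagonal block is either primitive or power bounded (a $(1\times1)$ diagonal block with entry $0$ or $1$ is counted as a PB block and not as a primitive block). *)

theory Defs
  imports "HOL-Library.Sublist" "Jordan_Normal_Form.Matrix"
begin

definition nonerasing_substitution_on :: "'a set \<Rightarrow> ('a \<Rightarrow> 'a list) \<Rightarrow> bool" where
  "nonerasing_substitution_on A \<zeta> \<longleftrightarrow> (\<forall>a\<in>A. \<zeta> a \<in> lists A \<and> \<zeta> a \<noteq> [])"

definition extend_subst :: "('a \<Rightarrow> 'b list) \<Rightarrow> 'a list \<Rightarrow> 'b list" where
  "extend_subst \<zeta> w = concat (map \<zeta> w)"

text \<open>The alphabet is given by a list of its letters, which fixes their order.\<close>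

definition incidence_mat :: "'a list \<Rightarrow> ('a \<Rightarrow> 'a list) \<Rightarrow> nat mat" where
  "incidence_mat as \<zeta> =
     mat (length as) (length as) (\<lambda>(i, j). count_list (\<zeta> (as ! j)) (as ! i))"

definition subst_language :: "'a set \<Rightarrow> ('a \<Rightarrow> 'a list) \<Rightarrow> 'a list set" where
  "subst_language A \<zeta> = {u. \<exists>a\<in>A. \<exists>k. sublist u ((extend_subst \<zeta> ^^ k) [a])}"

definition language_words :: "'a set \<Rightarrow> ('a \<Rightarrow> 'a list) \<Rightarrow> nat \<Rightarrow> 'a list set" where
  "language_words A \<zeta> n = {w \<in> subst_language A \<zeta>. length w = n}"

definition blow_up :: "nat \<Rightarrow> ('a \<Rightarrow> 'a list) \<Rightarrow> 'a list \<Rightarrow> 'a list list" where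
  "blow_up n \<zeta> w =
     map (\<lambda>i. take n (drop i (extend_subst \<zeta> w))) [0..<length (\<zeta> (hd w))]"

lemma blow_up_nonerasing_substitution_on:
  assumes "nonerasing_substitution_on A \<zeta>" and "n \<ge> 1"
  shows "nonerasing_substitution_on (language_words A \<zeta> n) (blow_up n \<zeta>)"
  unfolding nonerasing_substitution_on_def
proof (intro ballI conjI)
  fix w assume w: "w \<in> language_words A \<zeta> n"
  then obtain a k where a: "a \<in> A" and sub: "sublist w ((extend_subst \<zeta> ^^ k) [a])"
    and len: "length w = n"
    by (auto simp: language_words_def subst_language_def)
  have lists: "extend_subst \<zeta> v \<in> lists A" if "v \<in> lists A" for v
    using that assms(1)
    by (fastforce simp: extend_subst_def nonerasing_substitution_on_def in_lists_conv_set)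
  have "(extend_subst \<zeta> ^^ k) [a] \<in> lists A"
    by (induction k) (use a lists in auto)
  then have wA: "set w \<subseteq> A"
    using sub set_mono_sublist by (metis in_lists_conv_set subsetD subsetI)
  obtain b v where bv: "w = b # v" using len assms(2) by (cases w) auto
  have long: "length v \<le> length (extend_subst \<zeta> v)" if "set v \<subseteq> A" for v
    using that
  proof (induction v)
    case (Cons x v)
    then have "\<zeta> x \<noteq> []" using assms(1) by (auto simp: nonerasing_substitution_on_def)
    then have "length (\<zeta> x) \<ge> 1" by (cases "\<zeta> x") auto
    then show ?case using Cons by (auto simp: extend_subst_def)
  qed simp
  have lz: "length (\<zeta> b) + (n - 1) \<le> length (extend_subst \<zeta> w)"
    using long[of v] wA bv len by (auto simp: extend_subst_def)
  obtain p s where "(extend_subst \<zeta> ^^ k) [a] = p @ w @ s"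
    using sub by (auto simp: sublist_def)
  then have "(extend_subst \<zeta> ^^ Suc k) [a]
      = extend_subst \<zeta> p @ extend_subst \<zeta> w @ extend_subst \<zeta> s"
    by (simp add: extend_subst_def)
  then have sub': "sublist (extend_subst \<zeta> w) ((extend_subst \<zeta> ^^ Suc k) [a])"
    by (metis sublist_def)
  show "blow_up n \<zeta> w \<in> lists (language_words A \<zeta> n)"
    unfolding in_lists_conv_set
  proof
    fix u assume "u \<in> set (blow_up n \<zeta> w)"
    then obtain i where i: "i < length (\<zeta> b)" and u: "u = take n (drop i (extend_subst \<zeta> w))"
      by (auto simp: blow_up_def bv)
    have "sublist u (extend_subst \<zeta> w)"
      unfolding u by (metis sublist_drop sublist_take sublist_order.order_trans)
    then have "sublist u ((extend_subst \<zeta> ^^ Suc k) [a])"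
      using sub' sublist_order.order_trans by blast
    then have "u \<in> subst_language A \<zeta>"
      unfolding subst_language_def using a by blast
    moreover have "length u = n"
      using i lz assms(2) by (simp add: u)
    ultimately show "u \<in> language_words A \<zeta> n" by (simp add: language_words_def)
  qed
  show "blow_up n \<zeta> w \<noteq> []"
    using assms(1) wA by (auto simp: blow_up_def bv nonerasing_substitution_on_def)
qed

definition primitive_mat :: "nat mat \<Rightarrow> bool" where
  "primitive_mat N \<longleftrightarrow> square_mat N \<and>
     (\<exists>k\<ge>1. \<forall>i<dim_row N. \<forall>j<dim_row N. (N ^\<^sub>m k) $$ (i, j) > 0)"

definition power_bounded_mat :: "nat mat \<Rightarrow> bool" where
  "power_bounded_mat N \<longleftrightarrow> square_mat N \<and>
     (\<exists>C. \<forall>t\<ge>1. \<forall>i<dim_row N. \<forall>j<dim_row N. (N ^\<^sub>m t) $$ (i, j) \<le> C)"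

text \<open>A block decomposition with square diagonal blocks is given by the list of the sizes
  of the diagonal blocks.\<close>

definition mat_block :: "'a mat \<Rightarrow> nat list \<Rightarrow> nat \<Rightarrow> nat \<Rightarrow> 'a mat" where
  "mat_block N bs p q = mat (bs ! p) (bs ! q)
     (\<lambda>(i, j). N $$ (sum_list (take p bs) + i, sum_list (take q bs) + j))"

text \<open>The convention that a \<open>1 \<times> 1\<close> diagonal block with entry \<open>0\<close> or \<open>1\<close> counts as power bounded
  and not as primitive does not affect the disjunction below: both of these blocks are power
  bounded.\<close>

definition PB_Frobenius_form :: "nat mat \<Rightarrow> bool" where
  "PB_Frobenius_form N \<longleftrightarrow> square_mat N \<and>
     (\<exists>bs. 0 \<notin> set bs \<and> sum_list bs = dim_row N \<and>
        (\<forall>p q. p < q \<and> q < length bs \<longrightarrow> mat_block N bs p q = 0\<^sub>m (bs ! p) (bs ! q)) \<and>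
        (\<forall>p<length bs. primitive_mat (mat_block N bs p p) \<or>
                        power_bounded_mat (mat_block N bs p p)))"

end

theory Submission
  imports Defs
begin

text \<open>
  A matrix that counts letters is the adjacency matrix of the directed multigraph in which \<open>a\<close>
  points to the letters of \<open>\<sigma> a\<close>. The letters can be ordered so that it is in PB-Frobenius form as
  soon as every strongly connected component is primitive or power bounded: the components can be
  sorted topologically and then serve as blocks. Conversely a block decomposition assigns to
  each letter the index of its block, and this index never decreases along edges. Such
  a rank function on the letters (\<open>PB_ranking\<close>) replaces block matrices throughout; the
  translation rests on the fact that the \<open>t\<close>-th power of a diagonal block counts letters in the
  words \<open>\<sigma>^t a\<close>, because no path that leaves a block returns to it (\<open>incidence_mat_pow\<close>).

  Blow-up commutes with iteration: \<open>(\<zeta>_n)^t = (\<zeta>^t)_n\<close> (\<open>iter_blow_up\<close>). So \<open>u\<close> is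
  reached from \<open>w\<close> in \<open>t\<close> steps of \<open>\<zeta>_n\<close> iff \<open>u\<close> occurs in \<open>\<zeta>^t(w)\<close> at a position inside
  \<open>\<zeta>^t(hd w)\<close>. In particular first letters follow \<open>\<zeta>\<close>, hence the first letters of the words in one
  component \<open>C\<close> of \<open>\<zeta>_n\<close> all lie in one block \<open>L\<close> of \<open>\<zeta>\<close>. Three cases
  remain (\<open>blow_up_component\<close>).

  \<^item> \<open>L\<close> is power bounded. The occurrences of \<open>u\<close> in \<open>\<zeta>_n^t(w)\<close> are at most as many as those of
    \<open>hd u\<close> in \<open>\<zeta>^t(hd w)\<close>, so \<open>C\<close> is power bounded.

  \<^item> \<open>L\<close> is primitive and some \<open>w\<close> in \<open>C\<close> is a factor of some \<open>\<zeta>^s(b)\<close> with \<open>b\<close> in \<open>L\<close>. For large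
    \<open>k\<close> the letter \<open>b\<close> occurs in \<open>\<zeta>^k(hd v)\<close> for every \<open>v\<close> in \<open>C\<close>, so \<open>w\<close> is reached from every
    \<open>v\<close> in exactly \<open>K\<close> steps for all large \<open>K\<close>. As \<open>C\<close> is strongly connected, it is primitive.

  \<^item> No word of \<open>C\<close> is such a factor. Then every occurrence of \<open>u\<close> counted in \<open>\<zeta>_n^t(w)\<close> crosses the
    right end of \<open>\<zeta>^t(hd w)\<close>. There are fewer than \<open>n\<close> such positions, so \<open>C\<close> is power bounded.
\<close>

section \<open>Iterated substitutions\<close>

abbreviation iter_subst :: "('a \<Rightarrow> 'a list) \<Rightarrow> nat \<Rightarrow> 'a \<Rightarrow> 'a list" where
  "iter_subst \<sigma> t a \<equiv> (extend_subst \<sigma> ^^ t) [a]"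

lemma extend_subst_append [simp]:
  "extend_subst \<sigma> (u @ v) = extend_subst \<sigma> u @ extend_subst \<sigma> v"
  by (simp add: extend_subst_def)

lemma extend_subst_Nil [simp]: "extend_subst \<sigma> [] = []"
  by (simp add: extend_subst_def)

lemma extend_subst_Cons [simp]: "extend_subst \<sigma> (a # v) = \<sigma> a @ extend_subst \<sigma> v"
  by (simp add: extend_subst_def)

lemma set_extend_subst: "set (extend_subst \<sigma> w) = (\<Union>a\<in>set w. set (\<sigma> a))"
  by (simp add: extend_subst_def)

lemma funpow_extend_subst:
  "(extend_subst \<sigma> ^^ t) w = extend_subst (iter_subst \<sigma> t) w"
proof -
  have nil: "(extend_subst \<sigma> ^^ t) [] = []" by (induction t) auto
  have app: "(extend_subst \<sigma> ^^ t) (u @ v) = (extend_subst \<sigma> ^^ t) u @ (extend_subst \<sigma> ^^ t) v"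
    for u v by (induction t) auto
  show ?thesis
  proof (induction w)
    case (Cons a w)
    then show ?case using app[of "[a]" w] by simp
  qed (simp add: nil)
qed

lemma iter_subst_add:
  "iter_subst \<sigma> (s + t) a = extend_subst (iter_subst \<sigma> s) (iter_subst \<sigma> t a)"
  by (metis funpow_add comp_apply funpow_extend_subst)

lemma iter_subst_Suc:
  "iter_subst \<sigma> (Suc t) a = extend_subst (iter_subst \<sigma> t) (\<sigma> a)"
  using iter_subst_add[of t 1 \<sigma> a] by simp

lemma set_iter_subst_add:
  "b \<in> set (iter_subst \<sigma> (s + t) a) \<longleftrightarrow>
     (\<exists>c\<in>set (iter_subst \<sigma> t a). b \<in> set (iter_subst \<sigma> s c))"
  by (simp add: iter_subst_add set_extend_subst)

lemma count_list_extend_subst: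
  "count_list (extend_subst f w) b = (\<Sum>c\<in>set w. count_list w c * count_list (f c) b)"
proof -
  have "count_list (extend_subst f w) b = sum_list (map (\<lambda>c. count_list (f c) b) w)"
    by (induction w) auto
  then show ?thesis by (simp add: sum_list_map_eq_sum_count)
qed

lemma iter_subst_closed_mono:
  fixes r :: "'a \<Rightarrow> nat"
  assumes closed: "\<And>a. a \<in> S \<Longrightarrow> set (\<sigma> a) \<subseteq> S"
    and mono: "\<forall>a\<in>S. \<forall>b\<in>set (\<sigma> a). r a \<le> r b"
    and "a \<in> S" "b \<in> set (iter_subst \<sigma> t a)"
  shows "b \<in> S \<and> r a \<le> r b"
  using assms(3,4)
proof (induction t arbitrary: b)
  case (Suc t)
  then obtain c where "c \<in> set (iter_subst \<sigma> t a)" "b \<in> set (\<sigma> c)"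
    by (auto simp: set_extend_subst)
  with Suc closed mono show ?case by (meson order_trans subsetD)
qed auto

section \<open>Block decompositions as rankings of the letters\<close>

definition primitive_on :: "'a set \<Rightarrow> ('a \<Rightarrow> 'a list) \<Rightarrow> bool" where
  "primitive_on C \<sigma> \<longleftrightarrow> (\<exists>k\<ge>1. \<forall>a\<in>C. \<forall>b\<in>C. b \<in> set (iter_subst \<sigma> k a))"

definition power_bounded_on :: "'a set \<Rightarrow> ('a \<Rightarrow> 'a list) \<Rightarrow> bool" where
  "power_bounded_on C \<sigma> \<longleftrightarrow>
     (\<exists>K. \<forall>t\<ge>1. \<forall>a\<in>C. \<forall>b\<in>C. count_list (iter_subst \<sigma> t a) b \<le> K)"

text \<open>The level sets of \<open>r\<close> are the diagonal blocks. Empty levels are harmless, being power bounded,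
  so \<open>r\<close> may skip values.\<close>

definition PB_ranking :: "'a set \<Rightarrow> ('a \<Rightarrow> 'a list) \<Rightarrow> ('a \<Rightarrow> nat) \<Rightarrow> bool" where
  "PB_ranking S \<sigma> r \<longleftrightarrow> (\<forall>a\<in>S. \<forall>b\<in>set (\<sigma> a). r a \<le> r b) \<and>
     (\<forall>p. primitive_on {a\<in>S. r a = p} \<sigma> \<or> power_bounded_on {a\<in>S. r a = p} \<sigma>)"

text \<open>The letters in \<open>cs\<close> may be any part of the alphabet to which no path returns once it has left, as the
  second assumption says. In the matrix product only intermediate letters \<open>c\<close> in \<open>cs\<close> are summed
  over; the remaining letters of \<open>\<sigma> a\<close> contribute nothing to the count, since they never
  lead back to \<open>cs\<close>.\<close>

lemma incidence_mat_pow: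
  assumes "distinct cs"
    and conv: "\<And>a b c t. a \<in> set cs \<Longrightarrow> b \<in> set cs \<Longrightarrow> c \<in> set (\<sigma> a) \<Longrightarrow>
      b \<in> set (iter_subst \<sigma> t c) \<Longrightarrow> c \<in> set cs"
    and "i < length cs" "j < length cs"
  shows "(incidence_mat cs \<sigma> ^\<^sub>m t) $$ (i, j) = count_list (iter_subst \<sigma> t (cs ! j)) (cs ! i)"
  using assms(3,4)
proof (induction t arbitrary: i j)
  case 0
  then show ?case using assms(1)
    by (auto simp: incidence_mat_def nth_eq_iff_index_eq)
next
  case (Suc t)
  let ?N = "incidence_mat cs \<sigma>" and ?m = "length cs"
  let ?f = "\<lambda>c. count_list (\<sigma> (cs ! j)) c * count_list (iter_subst \<sigma> t c) (cs ! i)"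
  have N: "?N \<in> carrier_mat ?m ?m" by (simp add: incidence_mat_def)
  have "(?N ^\<^sub>m Suc t) $$ (i, j) = (\<Sum>l<?m. (?N ^\<^sub>m t) $$ (i, l) * ?N $$ (l, j))"
    using Suc.prems N pow_carrier_mat[OF N, of t]
    by (auto simp: scalar_prod_def atLeast0LessThan intro!: sum.cong)
  also have "\<dots> = (\<Sum>l<?m. ?f (cs ! l))"
    using Suc by (intro sum.cong) (auto simp: incidence_mat_def)
  also have "\<dots> = (\<Sum>c\<in>set cs. ?f c)"
    using bij_betw_nth[OF assms(1), of "{..<?m}" "set cs"] by (intro sum.reindex_bij_betw) auto
  also have "\<dots> = (\<Sum>c\<in>set (\<sigma> (cs ! j)). ?f c)"
  proof (intro sum.mono_neutral_cong)
    \<comment> \<open>The path from \<open>cs ! j\<close> through \<open>c\<close> has left \<open>cs\<close>, so it cannot end in \<open>cs ! i\<close>.\<close>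
    show "?f c = 0" if "c \<in> set (\<sigma> (cs ! j)) - set cs" for c
      using that conv[of "cs ! j" "cs ! i" c t] Suc.prems by (auto simp: count_list_0_iff)
  qed (auto simp: count_list_0_iff)
  also have "\<dots> = count_list (iter_subst \<sigma> (Suc t) (cs ! j)) (cs ! i)"
    unfolding iter_subst_Suc by (rule count_list_extend_subst[symmetric])
  finally show ?case .
qed

lemma primitive_or_bounded_incidence_mat_iff:
  assumes "distinct cs"
    and conv: "\<And>a b c t. a \<in> set cs \<Longrightarrow> b \<in> set cs \<Longrightarrow> c \<in> set (\<sigma> a) \<Longrightarrow>
      b \<in> set (iter_subst \<sigma> t c) \<Longrightarrow> c \<in> set cs"
  shows "primitive_mat (incidence_mat cs \<sigma>) \<longleftrightarrow> primitive_on (set cs) \<sigma>"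
    and "power_bounded_mat (incidence_mat cs \<sigma>) \<longleftrightarrow> power_bounded_on (set cs) \<sigma>"
proof -
  have sq: "square_mat (incidence_mat cs \<sigma>)" and dim: "dim_row (incidence_mat cs \<sigma>) = length cs"
    by (simp_all add: incidence_mat_def)
  note pow = incidence_mat_pow[OF assms]
  have pos: "0 < count_list xs x \<longleftrightarrow> x \<in> set xs" for xs :: "'a list" and x
    using count_list_0_iff[of xs x] by auto
  have swap: "(\<forall>i<length cs. \<forall>j<length cs. P (cs ! j) (cs ! i)) \<longleftrightarrow>
      (\<forall>a\<in>set cs. \<forall>b\<in>set cs. P a b)" for P
    by (auto simp: all_set_conv_all_nth)
  show "primitive_mat (incidence_mat cs \<sigma>) \<longleftrightarrow> primitive_on (set cs) \<sigma>"
    unfolding primitive_mat_def primitive_on_def dim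
    using sq by (simp del: square_mat.simps add: pow pos swap[symmetric])
  show "power_bounded_mat (incidence_mat cs \<sigma>) \<longleftrightarrow> power_bounded_on (set cs) \<sigma>"
    unfolding power_bounded_mat_def power_bounded_on_def dim
    using sq by (simp del: square_mat.simps add: pow swap[symmetric])
qed

lemma nth_concat_offset:
  assumes "p < length xss" "i < length (xss ! p)"
  shows "sum_list (take p (map length xss)) + i < length (concat xss)"
    and "concat xss ! (sum_list (take p (map length xss)) + i) = xss ! p ! i"
proof -
  have *: "concat xss = concat (take p xss) @ xss ! p @ concat (drop (Suc p) xss)"
    using assms(1) by (metis concat.simps(2) concat_append id_take_nth_drop)
  have l: "sum_list (take p (map length xss)) = length (concat (take p xss))"
    by (simp add: length_concat take_map)
  show "sum_list (take p (map length xss)) + i < length (concat xss)"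
    using assms(2) by (subst *) (simp add: l)
  show "concat xss ! (sum_list (take p (map length xss)) + i) = xss ! p ! i"
    using assms(2) by (subst *) (simp add: l nth_append)
qed

lemma mat_block_incidence_mat:
  assumes "p < length xss" "q < length xss"
  shows "mat_block (incidence_mat (concat xss) \<sigma>) (map length xss) p q =
     mat (length (xss ! p)) (length (xss ! q)) (\<lambda>(i, j). count_list (\<sigma> (xss ! q ! j)) (xss ! p ! i))"
  using assms
  by (intro eq_matI) (simp_all add: mat_block_def incidence_mat_def nth_concat_offset)

lemma concat_split_lengths:
  "sum_list bs = length xs \<Longrightarrow> \<exists>xss. concat xss = xs \<and> map length xss = bs"
proof (induction bs arbitrary: xs)
  case (Cons b bs)
  then obtain xss where "concat xss = drop b xs" "map length xss = bs"
    by (metis add_diff_cancel_left' length_drop sum_list.Cons)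
  then show ?case using Cons.prems by (intro exI[of _ "take b xs # xss"]) auto
qed simp

text \<open>A block decomposition of the matrix is the same as a decomposition of the list of letters into
  consecutive segments. Its diagonal blocks are then incidence matrices themselves, of the
  substitution with all letters outside the segment ignored.\<close>

lemma PB_Frobenius_form_incidence_mat_iff:
  "PB_Frobenius_form (incidence_mat as \<sigma>) \<longleftrightarrow>
     (\<exists>xss. concat xss = as \<and> [] \<notin> set xss \<and>
        (\<forall>p q. p < q \<and> q < length xss \<longrightarrow> (\<forall>a\<in>set (xss ! q). set (\<sigma> a) \<inter> set (xss ! p) = {})) \<and>
        (\<forall>cs\<in>set xss. primitive_mat (incidence_mat cs \<sigma>) \<or>
                       power_bounded_mat (incidence_mat cs \<sigma>)))"
    (is "_ \<longleftrightarrow> (\<exists>xss. ?Q xss)")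
proof -
  let ?N = "incidence_mat as \<sigma>"
  let ?P = "\<lambda>bs. 0 \<notin> set bs \<and> sum_list bs = dim_row ?N \<and>
        (\<forall>p q. p < q \<and> q < length bs \<longrightarrow> mat_block ?N bs p q = 0\<^sub>m (bs ! p) (bs ! q)) \<and>
        (\<forall>p<length bs. primitive_mat (mat_block ?N bs p p) \<or>
                        power_bounded_mat (mat_block ?N bs p p))"
  have dim: "square_mat ?N" "dim_row ?N = length as" by (simp_all add: incidence_mat_def)
  have key: "?P (map length xss) \<longleftrightarrow> ?Q xss" if "concat xss = as" for xss
  proof -
    have off: "mat_block ?N (map length xss) p q = 0\<^sub>m (map length xss ! p) (map length xss ! q) \<longleftrightarrow>
        (\<forall>a\<in>set (xss ! q). set (\<sigma> a) \<inter> set (xss ! p) = {})" if pq: "p < q" "q < length xss" for p q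
    proof -
      have "mat_block ?N (map length xss) p q = 0\<^sub>m (map length xss ! p) (map length xss ! q) \<longleftrightarrow>
        (\<forall>i<length (xss ! p). \<forall>j<length (xss ! q). count_list (\<sigma> (xss ! q ! j)) (xss ! p ! i) = 0)"
        using pq \<open>concat xss = as\<close> mat_block_incidence_mat[of p xss q \<sigma>] by (auto simp: mat_eq_iff)
      also have "\<dots> \<longleftrightarrow> (\<forall>a\<in>set (xss ! q). \<forall>b\<in>set (xss ! p). b \<notin> set (\<sigma> a))"
        by (auto simp: all_set_conv_all_nth count_list_0_iff)
      finally show ?thesis by auto
    qed
    have diag: "mat_block ?N (map length xss) p p = incidence_mat (xss ! p) \<sigma>" if "p < length xss" for p
      using that \<open>concat xss = as\<close> mat_block_incidence_mat[of p xss p \<sigma>]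
      by (simp add: incidence_mat_def)
    have "sum_list (map length xss) = dim_row ?N"
      using \<open>concat xss = as\<close> by (auto simp: dim length_concat)
    moreover have "0 \<notin> set (map length xss) \<longleftrightarrow> [] \<notin> set xss" by force
    ultimately show ?thesis
      using \<open>concat xss = as\<close> off diag unfolding all_set_conv_all_nth[of xss] by auto
  qed
  have "PB_Frobenius_form ?N \<longleftrightarrow> (\<exists>bs. ?P bs)"
    unfolding PB_Frobenius_form_def using dim(1) by blast
  also have "\<dots> \<longleftrightarrow> (\<exists>xss. ?Q xss)"
  proof
    assume "\<exists>bs. ?P bs"
    then obtain bs where bs: "?P bs" ..
    then have "sum_list bs = length as" using dim(2) by simp
    then obtain xss where xss: "concat xss = as" "map length xss = bs"
      using concat_split_lengths by blast
    have "?Q xss" using bs unfolding xss(2)[symmetric] key[OF xss(1)] .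
    then show "\<exists>xss. ?Q xss" ..
  next
    assume "\<exists>xss. ?Q xss"
    then obtain xss where xss: "?Q xss" ..
    then have "?P (map length xss)" unfolding key[OF conjunct1[OF xss]] .
    then show "\<exists>bs. ?P bs" ..
  qed
  finally show ?thesis .
qed

text \<open>Rank is monotone along paths, so a path between two letters of rank \<open>p\<close> stays in rank \<open>p\<close>. This is
  the hypothesis of \<open>incidence_mat_pow\<close> for the level sets.\<close>

lemma PB_ranking_convex:
  assumes "\<And>a. a \<in> S \<Longrightarrow> set (\<sigma> a) \<subseteq> S"
    and mono: "\<forall>a\<in>S. \<forall>b\<in>set (\<sigma> a). r a \<le> (r b :: nat)"
    and "a \<in> {a\<in>S. r a = p}" "b \<in> {a\<in>S. r a = p}"
    and "c \<in> set (\<sigma> a)" "b \<in> set (iter_subst \<sigma> t c)"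
  shows "c \<in> {a\<in>S. r a = p}"
proof -
  have c: "c \<in> S" using assms by auto
  have "r a \<le> r c" using mono assms by auto
  moreover have "r c \<le> r b"
    using iter_subst_closed_mono[OF assms(1) mono c assms(6)] by simp
  ultimately show ?thesis using c assms(3,4) by auto
qed

lemma PB_ranking_if_PB_Frobenius_form:
  assumes "distinct as" and closed: "\<And>a. a \<in> set as \<Longrightarrow> set (\<sigma> a) \<subseteq> set as"
    and "PB_Frobenius_form (incidence_mat as \<sigma>)"
  shows "\<exists>r. PB_ranking (set as) \<sigma> r"
proof -
  obtain xss where as: "concat xss = as"
    and off: "\<And>p q a. p < q \<Longrightarrow> q < length xss \<Longrightarrow> a \<in> set (xss ! q) \<Longrightarrow> set (\<sigma> a) \<inter> set (xss ! p) = {}"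
    and diag: "\<And>cs. cs \<in> set xss \<Longrightarrow> primitive_mat (incidence_mat cs \<sigma>) \<or>
                       power_bounded_mat (incidence_mat cs \<sigma>)"
    and ne: "[] \<notin> set xss"
    using assms(3) unfolding PB_Frobenius_form_incidence_mat_iff by blast
  have dist: "distinct xss" "\<And>p. p < length xss \<Longrightarrow> distinct (xss ! p)"
    "\<And>p q. p < length xss \<Longrightarrow> q < length xss \<Longrightarrow> p \<noteq> q \<Longrightarrow> set (xss ! p) \<inter> set (xss ! q) = {}"
  proof -
    show d: "distinct xss"
      using assms(1) ne unfolding as[symmetric] distinct_concat_iff by (simp add: removeAll_id)
    show "distinct (xss ! p)" if "p < length xss" for p
      using that assms(1) unfolding as[symmetric] distinct_concat_iff by simp
    show "set (xss ! p) \<inter> set (xss ! q) = {}" if "p < length xss" "q < length xss" "p \<noteq> q" for p q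
      using that d assms(1) unfolding as[symmetric] distinct_concat_iff
      by (simp add: nth_eq_iff_index_eq)
  qed
  define r where "r a = (LEAST p. p < length xss \<and> a \<in> set (xss ! p))" for a
  have ex: "\<exists>p. p < length xss \<and> a \<in> set (xss ! p)" if "a \<in> set as" for a
    using that unfolding as[symmetric] by (auto simp: in_set_conv_nth[of _ xss])
  have r: "r a < length xss \<and> a \<in> set (xss ! r a)" if "a \<in> set as" for a
    unfolding r_def using LeastI_ex[OF ex[OF that]] .
  have r_eq: "{a\<in>set as. r a = p} = set (xss ! p)" if "p < length xss" for p
  proof (intro equalityI subsetI)
    fix a assume a: "a \<in> set (xss ! p)"
    then have "a \<in> set as" using that unfolding as[symmetric] by auto
    then show "a \<in> {a\<in>set as. r a = p}" using r[of a] dist(3)[of p "r a"] that a by auto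
  qed (use r in auto)
  have mono: "\<forall>a\<in>set as. \<forall>b\<in>set (\<sigma> a). r a \<le> r b"
  proof (intro ballI)
    fix a b assume ab: "a \<in> set as" "b \<in> set (\<sigma> a)"
    then have "b \<in> set as" using closed by auto
    then show "r a \<le> r b" using off[of "r b" "r a" a] r[of a] r[of b] ab by fastforce
  qed
  have "primitive_on {a\<in>set as. r a = p} \<sigma> \<or> power_bounded_on {a\<in>set as. r a = p} \<sigma>" for p
  proof (cases "p < length xss")
    case True
    have "primitive_on (set (xss ! p)) \<sigma> \<longleftrightarrow> primitive_mat (incidence_mat (xss ! p) \<sigma>)"
      "power_bounded_on (set (xss ! p)) \<sigma> \<longleftrightarrow> power_bounded_mat (incidence_mat (xss ! p) \<sigma>)"
      using primitive_or_bounded_incidence_mat_iff[of "xss ! p" \<sigma>] dist(2)[OF True]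
        PB_ranking_convex[OF closed mono, of _ p] unfolding r_eq[OF True] by blast+
    then show ?thesis unfolding r_eq[OF True] using diag True by simp
  next
    case False
    then have "{a\<in>set as. r a = p} = {}" using r by auto
    then show ?thesis unfolding power_bounded_on_def by (metis empty_iff)
  qed
  with mono show ?thesis unfolding PB_ranking_def by blast
qed

lemma PB_Frobenius_form_if_PB_ranking:
  assumes "finite S" and closed: "\<And>a. a \<in> S \<Longrightarrow> set (\<sigma> a) \<subseteq> S"
    and "PB_ranking S \<sigma> r"
  shows "\<exists>as. distinct as \<and> set as = S \<and> PB_Frobenius_form (incidence_mat as \<sigma>)"
proof -
  have mono: "\<forall>a\<in>S. \<forall>b\<in>set (\<sigma> a). r a \<le> r b"
    and levels: "\<And>p. primitive_on {a\<in>S. r a = p} \<sigma> \<or> power_bounded_on {a\<in>S. r a = p} \<sigma>"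
    using assms(3) unfolding PB_ranking_def by auto
  have "\<exists>xs. set xs = {a\<in>S. r a = p} \<and> distinct xs" for p
    by (rule finite_distinct_list) (simp add: assms(1))
  then obtain lev where lev: "\<And>p. set (lev p) = {a\<in>S. r a = p}" "\<And>p. distinct (lev p)"
    by metis
  define ps where "ps = sorted_list_of_set (r ` S)"
  have ps: "set ps = r ` S" "sorted_wrt (<) ps" "distinct ps"
    using assms(1) unfolding ps_def by simp_all
  let ?xss = "map lev ps"
  have "distinct (concat ?xss)"
    using ps(3)
  proof (induction ps)
    case (Cons p ps)
    then show ?case using lev by auto
  qed simp
  moreover have "set (concat ?xss) = S" by (auto simp: ps(1) lev(1))
  moreover have "PB_Frobenius_form (incidence_mat (concat ?xss) \<sigma>)"
    unfolding PB_Frobenius_form_incidence_mat_iff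
  proof (intro exI[of _ ?xss] conjI allI impI ballI)
    show "[] \<notin> set ?xss"
      using lev(1) ps(1) by (auto simp: image_iff) (metis (mono_tags, lifting) empty_iff list.set(1) mem_Collect_eq)
  next
    fix p q a assume "p < q \<and> q < length ?xss" "a \<in> set (?xss ! q)"
    then show "set (\<sigma> a) \<inter> set (?xss ! p) = {}"
      using mono sorted_wrt_nth_less[OF ps(2), of p q] by (fastforce simp: lev(1))
  next
    fix cs assume "cs \<in> set ?xss"
    then obtain p where cs: "cs = lev p" by auto
    have "primitive_on (set cs) \<sigma> \<longleftrightarrow> primitive_mat (incidence_mat cs \<sigma>)"
      "power_bounded_on (set cs) \<sigma> \<longleftrightarrow> power_bounded_mat (incidence_mat cs \<sigma>)"
      using primitive_or_bounded_incidence_mat_iff[of cs \<sigma>] lev(2)[of p]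
        PB_ranking_convex[OF closed mono, of _ p] unfolding cs lev(1) by blast+
    then show "primitive_mat (incidence_mat cs \<sigma>) \<or> power_bounded_mat (incidence_mat cs \<sigma>)"
      using levels[of p] unfolding cs lev(1) by simp
  qed simp
  ultimately show ?thesis by blast
qed

section \<open>Ranking strongly connected components\<close>

text \<open>A topological sort in which distinct equivalence classes get distinct ranks. The number of
  predecessors is monotone, but may agree for incomparable classes; the term \<open>f (down x)\<close>, an
  arbitrary code below \<open>m\<close> of the set of predecessors, breaks these ties without disturbing the
  order.\<close>

lemma finite_preorder_ranking:
  assumes "finite S" and refl: "\<And>x. x \<in> S \<Longrightarrow> R x x"
    and trans: "\<And>x y z. x \<in> S \<Longrightarrow> y \<in> S \<Longrightarrow> z \<in> S \<Longrightarrow> R x y \<Longrightarrow> R y z \<Longrightarrow> R x z"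
  shows "\<exists>r :: 'a \<Rightarrow> nat. \<forall>x\<in>S. \<forall>y\<in>S. (R x y \<longrightarrow> r x \<le> r y) \<and> (r x = r y \<longrightarrow> R x y)"
proof -
  define down where "down x = {y\<in>S. R y x}" for x
  obtain f :: "'a set \<Rightarrow> nat" and m where f: "f ` Pow S = {i. i < m}" "inj_on f (Pow S)"
    using finite_imp_inj_to_nat_seg[of "Pow S"] assms(1) by auto
  have down: "down x \<in> Pow S" for x by (auto simp: down_def)
  have fm: "f (down x) < m" for x using f(1) down by blast
  define r where "r x = card (down x) * m + f (down x)" for x
  have "r x \<le> r y" if "x \<in> S" "y \<in> S" "R x y" for x y
  proof (cases "down x = down y")
    case False
    moreover have "down x \<subseteq> down y"
      unfolding down_def using trans[OF _ that(1,2) _ that(3)] by blast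
    ultimately have "down x \<subset> down y" by blast
    then have "card (down x) < card (down y)"
      using assms(1) by (intro psubset_card_mono) (auto simp: down_def)
    then have "(card (down x) + 1) * m \<le> card (down y) * m" by (intro mult_le_mono1) simp
    then show ?thesis using fm[of x] unfolding r_def by simp
  qed (simp add: r_def)
  moreover have "R x y" if "x \<in> S" "y \<in> S" "r x = r y" for x y
  proof -
    have "f (down x) = f (down y)"
      using arg_cong[OF that(3), of "\<lambda>n. n mod m"] fm[of x] fm[of y] by (simp add: r_def)
    then have "down x = down y" using f(2) down by (meson inj_onD)
    then show ?thesis using that refl by (auto simp: down_def)
  qed
  ultimately show ?thesis by blast
qed

text \<open>Reachability is a preorder, and the level sets of the rank function that
  \<open>finite_preorder_ranking\<close> gives for it are the strongly connected components.\<close>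

lemma PB_ranking_if_components:
  assumes "finite S" and closed: "\<And>a. a \<in> S \<Longrightarrow> set (\<sigma> a) \<subseteq> S"
    and comp: "\<And>C. C \<subseteq> S \<Longrightarrow> \<forall>a\<in>C. \<forall>b\<in>C. \<exists>t. b \<in> set (iter_subst \<sigma> t a) \<Longrightarrow>
      primitive_on C \<sigma> \<or> power_bounded_on C \<sigma>"
  shows "\<exists>r. PB_ranking S \<sigma> r"
proof -
  define R where "R a b \<longleftrightarrow> (\<exists>t. b \<in> set (iter_subst \<sigma> t a))" for a b
  have refl: "R a a" for a unfolding R_def by (intro exI[of _ 0]) simp
  have trans: "R a c" if "R a b" "R b c" for a b c
    using that set_iter_subst_add unfolding R_def by metis
  obtain r :: "'a \<Rightarrow> nat"
    where r: "\<forall>x\<in>S. \<forall>y\<in>S. (R x y \<longrightarrow> r x \<le> r y) \<and> (r x = r y \<longrightarrow> R x y)"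
    using finite_preorder_ranking[of S R, OF assms(1) refl] trans by metis
  have "R a b" if "b \<in> set (\<sigma> a)" for a b
    unfolding R_def by (intro exI[of _ 1]) (simp add: that)
  then have "\<forall>a\<in>S. \<forall>b\<in>set (\<sigma> a). r a \<le> r b" using r closed by blast
  moreover have "primitive_on {a\<in>S. r a = p} \<sigma> \<or> power_bounded_on {a\<in>S. r a = p} \<sigma>" for p
    using r by (intro comp) (auto simp: R_def)
  ultimately show ?thesis unfolding PB_ranking_def by blast
qed

section \<open>Iterated blow-up substitutions\<close>

lemma length_extend_subst_ge:
  assumes "nonerasing_substitution_on A \<zeta>" "set w \<subseteq> A"
  shows "length w \<le> length (extend_subst \<zeta> w)"
  using assms(2)
proof (induction w)
  case (Cons a w)
  then have "\<zeta> a \<noteq> []" using assms(1) by (auto simp: nonerasing_substitution_on_def)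
  then show ?case using Cons by (cases "\<zeta> a") auto
qed simp

lemma extend_subst_closed:
  assumes "nonerasing_substitution_on A \<zeta>" "set w \<subseteq> A"
  shows "set (extend_subst \<zeta> w) \<subseteq> A"
  using assms unfolding nonerasing_substitution_on_def set_extend_subst by blast

lemma nonerasing_iter_subst:
  assumes "nonerasing_substitution_on A \<zeta>"
  shows "nonerasing_substitution_on A (iter_subst \<zeta> t)"
  unfolding nonerasing_substitution_on_def
proof
  fix a assume a: "a \<in> A"
  have "set (iter_subst \<zeta> t a) \<subseteq> A \<and> length (iter_subst \<zeta> t a) \<ge> 1"
  proof (induction t)
    case (Suc t)
    then show ?case
      using extend_subst_closed[OF assms] length_extend_subst_ge[OF assms] by fastforce
  qed (use a in auto)
  then show "iter_subst \<zeta> t a \<in> lists A \<and> iter_subst \<zeta> t a \<noteq> []" by auto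
qed

text \<open>The \<open>m\<close>-th window of \<open>W\<close> is mapped to the windows of \<open>\<zeta>(W)\<close> that begin inside the image of the
  letter \<open>W ! m\<close>. These windows are not cut short, because the \<open>n - 1\<close> letters after \<open>W ! m\<close> have
  non-empty images.\<close>

lemma blow_up_window:
  assumes ne: "nonerasing_substitution_on A \<zeta>" and "set W \<subseteq> A" "n \<ge> 1" "m + n \<le> length W"
  shows "blow_up n \<zeta> (take n (drop m W)) =
    map (\<lambda>i. take n (drop (length (extend_subst \<zeta> (take m W)) + i) (extend_subst \<zeta> W)))
      [0..<length (\<zeta> (W ! m))]"
proof -
  let ?V = "take n (drop m W)"
  obtain n' where n': "n = Suc n'" using assms(3) by (cases n) auto
  have "drop m W = W ! m # drop (Suc m) W"
    using assms(3,4) by (intro Cons_nth_drop_Suc[symmetric]) simp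
  then have hdV: "hd ?V = W ! m" and V: "?V = W ! m # drop 1 ?V" by (simp_all add: n')
  have "set ?V \<subseteq> A" using assms(2) by (meson set_drop_subset set_take_subset subset_trans)
  then have "length (drop 1 ?V) \<le> length (extend_subst \<zeta> (drop 1 ?V))"
    by (intro length_extend_subst_ge[OF ne]) (meson set_drop_subset subset_trans)
  moreover have "extend_subst \<zeta> ?V = \<zeta> (W ! m) @ extend_subst \<zeta> (drop 1 ?V)"
    by (subst V) simp
  ultimately have len: "length (\<zeta> (W ! m)) + (n - 1) \<le> length (extend_subst \<zeta> ?V)"
    using assms by simp
  have "W = take m W @ ?V @ drop n (drop m W)"
    by (metis append_take_drop_id)
  then have W: "extend_subst \<zeta> W =
      extend_subst \<zeta> (take m W) @ extend_subst \<zeta> ?V @ extend_subst \<zeta> (drop n (drop m W))"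
    by (metis extend_subst_append)
  show ?thesis
    unfolding blow_up_def hdV using len assms(3) by (subst W) auto
qed

lemma extend_subst_blow_up_windows:
  assumes ne: "nonerasing_substitution_on A \<zeta>" and "set W \<subseteq> A" "n \<ge> 1" "m + n \<le> Suc (length W)"
  shows "extend_subst (blow_up n \<zeta>) (map (\<lambda>i. take n (drop i W)) [0..<m]) =
    map (\<lambda>i. take n (drop i (extend_subst \<zeta> W))) [0..<length (extend_subst \<zeta> (take m W))]"
  using assms(4)
proof (induction m)
  case (Suc m)
  let ?L = "length (extend_subst \<zeta> (take m W))"
  have "take (Suc m) W = take m W @ [W ! m]"
    using Suc.prems assms(3) by (simp add: take_Suc_conv_app_nth)
  then have "[0..<length (extend_subst \<zeta> (take (Suc m) W))] =
      [0..<?L] @ map (\<lambda>i. ?L + i) [0..<length (\<zeta> (W ! m))]"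
    using upt_add_eq_append[of 0 ?L "length (\<zeta> (W ! m))"] map_add_upt[of ?L "length (\<zeta> (W ! m))"]
    by (simp add: add.commute)
  then show ?case
    using Suc blow_up_window[OF ne assms(2,3), of m] by (simp add: comp_def)
qed simp

text \<open>Blowing up commutes with iteration, by gluing the pieces of \<open>blow_up_window\<close> for the
  consecutive windows of \<open>\<zeta>^t(w)\<close>.\<close>

lemma iter_blow_up:
  assumes ne: "nonerasing_substitution_on A \<zeta>" and w: "set w \<subseteq> A" "length w = n" "n \<ge> 1"
  shows "iter_subst (blow_up n \<zeta>) t w = blow_up n (iter_subst \<zeta> t) w"
proof (induction t)
  case 0
  have "extend_subst (iter_subst \<zeta> 0) w = w" for w using funpow_extend_subst[of 0 \<zeta> w] by simp
  then show ?case using w by (simp add: blow_up_def)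
next
  case (Suc t)
  let ?W = "extend_subst (iter_subst \<zeta> t) w" and ?m = "length (iter_subst \<zeta> t (hd w))"
  note ne' = nonerasing_iter_subst[OF ne, of t]
  obtain b v where bv: "w = b # v" using w by (cases w) auto
  have "length v \<le> length (extend_subst (iter_subst \<zeta> t) v)"
    using w bv by (intro length_extend_subst_ge[OF ne']) auto
  then have m: "?m + n \<le> Suc (length ?W)" using w bv by simp
  have "take ?m ?W = iter_subst \<zeta> t (hd w)" by (simp add: bv)
  moreover have "extend_subst \<zeta> ?W = extend_subst (iter_subst \<zeta> (Suc t)) w"
    using funpow_extend_subst[of t \<zeta> w] funpow_extend_subst[of "Suc t" \<zeta> w] by simp
  moreover have "iter_subst (blow_up n \<zeta>) (Suc t) w =
      extend_subst (blow_up n \<zeta>) (map (\<lambda>i. take n (drop i ?W)) [0..<?m])"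
    using Suc by (simp add: blow_up_def[of n "iter_subst \<zeta> t"])
  ultimately show ?case
    using extend_subst_blow_up_windows[OF ne extend_subst_closed[OF ne' w(1)] w(3) m]
    by (simp add: blow_up_def[of n "\<lambda>a. extend_subst \<zeta> (iter_subst \<zeta> t a)"])
qed

text \<open>The first letters of the windows are the letters at which the windows begin, so taking first
  letters carries \<open>\<zeta>_n\<close> to \<open>\<zeta>\<close>.\<close>

lemma map_hd_blow_up:
  assumes ne: "nonerasing_substitution_on A \<zeta>" and w: "set w \<subseteq> A" "length w = n" "n \<ge> 1"
  shows "map hd (blow_up n \<zeta> w) = \<zeta> (hd w)"
proof -
  obtain b v where bv: "w = b # v" using w by (cases w) auto
  show ?thesis
    using w(3) by (intro nth_equalityI) (auto simp: blow_up_def bv hd_drop_conv_nth nth_append)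
qed

lemma sublist_in_blow_up:
  assumes "w \<noteq> []" "sublist u (\<zeta> (hd w))" "length u = n" "n \<ge> 1"
  shows "u \<in> set (blow_up n \<zeta> w)"
proof -
  obtain x y where xy: "\<zeta> (hd w) = x @ u @ y" using assms(2) by (auto simp: sublist_def)
  have "extend_subst \<zeta> w = \<zeta> (hd w) @ extend_subst \<zeta> (tl w)"
    using assms(1) by (cases w) auto
  then have "take n (drop (length x) (extend_subst \<zeta> w)) = u" using assms(3) xy by simp
  then show ?thesis using xy assms(3,4) unfolding blow_up_def by force
qed

text \<open>All but the last \<open>n\<close> windows lie inside \<open>\<zeta> (hd w)\<close>, where \<open>u\<close> does not occur.\<close>

lemma count_list_blow_up_straddling:
  assumes "w \<noteq> []" "\<not> sublist u (\<zeta> (hd w))"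
  shows "count_list (blow_up n \<zeta> w) u \<le> n"
proof -
  let ?m = "length (\<zeta> (hd w))" and ?g = "\<lambda>i. take n (drop i (extend_subst \<zeta> w))"
  have W: "extend_subst \<zeta> w = \<zeta> (hd w) @ extend_subst \<zeta> (tl w)"
    using assms(1) by (cases w) auto
  have "u \<noteq> ?g i" if "i < ?m - n" for i
  proof -
    have "?g i = take n (drop i (\<zeta> (hd w)))" using that by (simp add: W)
    then show ?thesis using assms(2) by (metis sublist_drop sublist_take sublist_order.order_trans)
  qed
  then have "count_list (map ?g [0..<?m - n]) u = 0"
    by (auto simp: count_list_0_iff image_iff)
  moreover have "[0..<?m] = [0..<?m - n] @ [?m - n..<?m]"
    using upt_add_eq_append[of 0 "?m - n" "?m - (?m - n)"] by simp
  ultimately have "count_list (blow_up n \<zeta> w) u = count_list (map ?g [?m - n..<?m]) u"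
    by (simp add: blow_up_def)
  also have "\<dots> \<le> length (map ?g [?m - n..<?m])" by (rule count_le_length)
  finally show ?thesis by simp
qed

lemma set_language_word:
  assumes "nonerasing_substitution_on A \<zeta>" "w \<in> language_words A \<zeta> n"
  shows "set w \<subseteq> A"
proof -
  obtain a k where "a \<in> A" "sublist w (iter_subst \<zeta> k a)"
    using assms(2) by (auto simp: language_words_def subst_language_def)
  then show ?thesis
    using nonerasing_iter_subst[OF assms(1), of k] set_mono_sublist
    unfolding nonerasing_substitution_on_def by blast
qed

lemma finite_language_words:
  assumes "nonerasing_substitution_on A \<zeta>" "finite A"
  shows "finite (language_words A \<zeta> n)"
proof (rule finite_subset)
  show "language_words A \<zeta> n \<subseteq> {w. set w \<subseteq> A \<and> length w = n}"
    using set_language_word[OF assms(1)] by (auto simp: language_words_def)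
qed (rule finite_lists_length_eq[OF assms(2)])

section \<open>Components of the blow-up\<close>

text \<open>Positivity of one power of a primitive block persists for all later powers: since \<open>a\<close> lies on a
  cycle, it has a successor \<open>c\<close> in the block, and a path of length \<open>K\<close> from \<open>c\<close> to \<open>b\<close> extends to one
  of length \<open>K + 1\<close> from \<open>a\<close>.\<close>

lemma primitive_on_all_large:
  assumes closed: "\<And>a. a \<in> S \<Longrightarrow> set (\<sigma> a) \<subseteq> S"
    and mono: "\<forall>a\<in>S. \<forall>b\<in>set (\<sigma> a). r a \<le> (r b :: nat)"
    and "primitive_on {a\<in>S. r a = p} \<sigma>"
  obtains k where "\<And>K a b. K \<ge> k \<Longrightarrow> a \<in> S \<Longrightarrow> r a = p \<Longrightarrow> b \<in> S \<Longrightarrow> r b = p \<Longrightarrow>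
    b \<in> set (iter_subst \<sigma> K a)"
proof -
  let ?L = "{a\<in>S. r a = p}"
  obtain k where k: "k \<ge> 1" "\<And>a b. a \<in> ?L \<Longrightarrow> b \<in> ?L \<Longrightarrow> b \<in> set (iter_subst \<sigma> k a)"
    using assms(3) unfolding primitive_on_def by blast
  have "b \<in> set (iter_subst \<sigma> K a)" if "K \<ge> k" "a \<in> ?L" "b \<in> ?L" for K a b
    using that
  proof (induction K arbitrary: a rule: dec_induct)
    case (step K)
    obtain k' where k': "k = Suc k'" using k(1) by (cases k) auto
    obtain c where c: "c \<in> set (\<sigma> a)" "a \<in> set (iter_subst \<sigma> k' c)"
      using k(2)[OF step.prems(1,1)] unfolding k' iter_subst_Suc set_extend_subst by blast
    then have "c \<in> ?L" using PB_ranking_convex[OF closed mono step.prems(1,1)] by blast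
    then have "b \<in> set (iter_subst \<sigma> K c)" using step by blast
    then show ?case using c(1) unfolding iter_subst_Suc set_extend_subst by blast
  qed (use k in blast)
  then show ?thesis using that by blast
qed

text \<open>One letter \<open>w\<close> that is reached from everywhere at all large times makes a component primitive:
  from \<open>v\<close> go to \<open>w\<close>, then along a path of length \<open>t u\<close> to \<open>u\<close>, choosing the time of arrival at \<open>w\<close>
  such that the total length is the same for all \<open>u\<close> and \<open>v\<close>.\<close>

lemma primitive_on_if_eventually_reached:
  assumes "finite C" "w \<in> C" and conn: "\<forall>u\<in>C. \<exists>t. u \<in> set (iter_subst \<sigma> t w)"
    and ev: "\<And>K v. K \<ge> k \<Longrightarrow> v \<in> C \<Longrightarrow> w \<in> set (iter_subst \<sigma> K v)"
  shows "primitive_on C \<sigma>"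
proof -
  obtain t where t: "\<And>u. u \<in> C \<Longrightarrow> u \<in> set (iter_subst \<sigma> (t u) w)" using conn by metis
  define T where "T = Max (t ` C)"
  have T: "t u \<le> T" if "u \<in> C" for u using that assms(1) by (simp add: T_def)
  have "u \<in> set (iter_subst \<sigma> (Suc (k + T)) v)" if "v \<in> C" "u \<in> C" for u v
  proof -
    have "w \<in> set (iter_subst \<sigma> (Suc (k + T) - t u) v)"
      using T[OF that(2)] that(1) by (intro ev) auto
    moreover have "Suc (k + T) = t u + (Suc (k + T) - t u)" using T[OF that(2)] by simp
    ultimately show ?thesis using t[OF that(2)] set_iter_subst_add by metis
  qed
  then show ?thesis unfolding primitive_on_def by (intro exI[of _ "Suc (k + T)"]) auto
qed

text \<open>The dichotomy for components of \<open>\<zeta>_n\<close>. If its words start in a primitive block of \<open>\<zeta>\<close>, a component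
  is primitive when one of its words occurs inside an iterated image of a single letter of that
  block, and power bounded when its words only occur across the ends of such images.\<close>

lemma blow_up_component:
  assumes ne: "nonerasing_substitution_on A \<zeta>" and "finite A" "PB_ranking A \<zeta> r" "n \<ge> 1"
    and C: "C \<subseteq> language_words A \<zeta> n"
    and conn: "\<forall>u\<in>C. \<forall>v\<in>C. \<exists>t. v \<in> set (iter_subst (blow_up n \<zeta>) t u)"
  shows "primitive_on C (blow_up n \<zeta>) \<or> power_bounded_on C (blow_up n \<zeta>)"
proof (cases "C = {}")
  case True
  then show ?thesis by (simp add: power_bounded_on_def)
next
  case False
  then obtain w0 where w0: "w0 \<in> C" by blast
  let ?p = "r (hd w0)" and ?\<sigma> = "blow_up n \<zeta>"
  let ?L = "{a\<in>A. r a = ?p}"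
  have closed: "\<And>a. a \<in> A \<Longrightarrow> set (\<zeta> a) \<subseteq> A"
    using ne unfolding nonerasing_substitution_on_def by blast
  have mono: "\<forall>a\<in>A. \<forall>b\<in>set (\<zeta> a). r a \<le> r b"
    and level: "primitive_on ?L \<zeta> \<or> power_bounded_on ?L \<zeta>"
    using assms(3) unfolding PB_ranking_def by auto
  have word: "set w \<subseteq> A" "length w = n" "w \<noteq> []" "hd w \<in> A" if "w \<in> C" for w
  proof -
    have "w \<in> language_words A \<zeta> n" using that C by blast
    then show "set w \<subseteq> A" "length w = n"
      using set_language_word[OF ne] by (simp_all add: language_words_def)
    then show "w \<noteq> []" using assms(4) by auto
    then show "hd w \<in> A" using \<open>set w \<subseteq> A\<close> hd_in_set by blast
  qed
  have iter: "iter_subst ?\<sigma> t w = blow_up n (iter_subst \<zeta> t) w" if "w \<in> C" for w t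
    using iter_blow_up[OF ne] word[OF that] assms(4) by blast
  have hds: "map hd (iter_subst ?\<sigma> t w) = iter_subst \<zeta> t (hd w)" if "w \<in> C" for w t
    using iter[OF that] map_hd_blow_up[OF nonerasing_iter_subst[OF ne]] word[OF that] assms(4) by simp
  have le: "r (hd u) \<le> r (hd v)" if uv: "u \<in> C" "v \<in> C" for u v
  proof -
    obtain t where "v \<in> set (iter_subst ?\<sigma> t u)"
      using conn uv by blast
    then have "hd v \<in> set (map hd (iter_subst ?\<sigma> t u))" unfolding set_map by (rule imageI)
    then have "hd v \<in> set (iter_subst \<zeta> t (hd u))" unfolding hds[OF uv(1)] .
    then show ?thesis using iter_subst_closed_mono[OF closed mono word(4)[OF uv(1)]] by blast
  qed
  \<comment> \<open>The component returns to \<open>w0\<close>, so ranks of first letters cannot increase within it.\<close>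
  have hdL: "hd w \<in> ?L" if "w \<in> C" for w
    using le[OF that w0] le[OF w0 that] word(4)[OF that] by simp
  consider (bounded) "power_bounded_on ?L \<zeta>"
    | (inner) w b s where "primitive_on ?L \<zeta>" "w \<in> C" "b \<in> ?L" "sublist w (iter_subst \<zeta> s b)"
    | (straddling) "\<And>w b s. w \<in> C \<Longrightarrow> b \<in> ?L \<Longrightarrow> \<not> sublist w (iter_subst \<zeta> s b)"
    using level by blast
  then show ?thesis
  proof cases
    case bounded
    then obtain K where K: "\<And>t a b. t \<ge> 1 \<Longrightarrow> a \<in> ?L \<Longrightarrow> b \<in> ?L \<Longrightarrow>
        count_list (iter_subst \<zeta> t a) b \<le> K"
      unfolding power_bounded_on_def by blast
    have "count_list (iter_subst ?\<sigma> t u) v \<le> K" if "t \<ge> 1" "u \<in> C" "v \<in> C" for t u v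
      using count_list_map_ge[of "iter_subst ?\<sigma> t u" v hd] K[OF that(1) hdL[OF that(2)] hdL[OF that(3)]]
      unfolding hds[OF that(2)] by simp
    then show ?thesis unfolding power_bounded_on_def by blast
  next
    case inner
    obtain k where k: "\<And>K a b. K \<ge> k \<Longrightarrow> a \<in> A \<Longrightarrow> r a = ?p \<Longrightarrow> b \<in> A \<Longrightarrow> r b = ?p \<Longrightarrow>
        b \<in> set (iter_subst \<zeta> K a)"
      using primitive_on_all_large[OF closed mono inner(1)] by blast
    have "w \<in> set (iter_subst ?\<sigma> K v)" if "K \<ge> s + k" "v \<in> C" for K v
    proof -
      have K: "K = s + (K - s)" using that(1) by simp
      have "b \<in> set (iter_subst \<zeta> (K - s) (hd v))"
        using k[of "K - s" "hd v" b] hdL[OF that(2)] inner(3) that(1) by simp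
      then obtain x y where "iter_subst \<zeta> (K - s) (hd v) = x @ b # y"
        by (meson split_list)
      then have "iter_subst \<zeta> K (hd v) =
          extend_subst (iter_subst \<zeta> s) x @ iter_subst \<zeta> s b @ extend_subst (iter_subst \<zeta> s) y"
        using iter_subst_add[of s "K - s" \<zeta> "hd v"] K by simp
      then have "sublist (iter_subst \<zeta> s b) (iter_subst \<zeta> K (hd v))"
        by (metis sublist_def)
      with inner(4) have "sublist w (iter_subst \<zeta> K (hd v))"
        by (rule sublist_order.order_trans)
      then show ?thesis
        unfolding iter[OF that(2)]
        by (rule sublist_in_blow_up[OF word(3)[OF that(2)] _ word(2)[OF inner(2)] assms(4)])
    qed
    moreover have "finite C"
      using C finite_language_words[OF ne assms(2)] by (rule finite_subset)
    ultimately have "primitive_on C ?\<sigma>"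
      using primitive_on_if_eventually_reached[of C w ?\<sigma> "s + k"] inner(2) conn by metis
    then show ?thesis ..
  next
    case straddling
    have "count_list (iter_subst ?\<sigma> t u) v \<le> n" if "u \<in> C" "v \<in> C" for t u v
      unfolding iter[OF that(1)]
      by (intro count_list_blow_up_straddling word(3) straddling hdL that)
    then show ?thesis unfolding power_bounded_on_def by blast
  qed
qed

theorem proposition3p5:
  fixes \<zeta> :: "'a \<Rightarrow> 'a list" and as :: "'a list" and n :: nat
  assumes "distinct as"
    and "nonerasing_substitution_on (set as) \<zeta>"
    and "PB_Frobenius_form (incidence_mat as \<zeta>)"
    and "n \<ge> 1"
  shows "\<exists>ws. distinct ws \<and> set ws = language_words (set as) \<zeta> n \<and>
           PB_Frobenius_form (incidence_mat ws (blow_up n \<zeta>))"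
proof -
  let ?S = "language_words (set as) \<zeta> n"
  have "\<And>a. a \<in> set as \<Longrightarrow> set (\<zeta> a) \<subseteq> set as"
    using assms(2) unfolding nonerasing_substitution_on_def by blast
  then obtain r where r: "PB_ranking (set as) \<zeta> r"
    using PB_ranking_if_PB_Frobenius_form[OF assms(1) _ assms(3)] by blast
  have fin: "finite ?S" using finite_language_words[OF assms(2)] by simp
  have closed: "\<And>w. w \<in> ?S \<Longrightarrow> set (blow_up n \<zeta> w) \<subseteq> ?S"
    using blow_up_nonerasing_substitution_on[OF assms(2,4)]
    unfolding nonerasing_substitution_on_def by blast
  obtain r' where r': "PB_ranking ?S (blow_up n \<zeta>) r'"
    using PB_ranking_if_components[OF fin closed blow_up_component[OF assms(2) finite_set r assms(4)]]
    by metis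
  show ?thesis
    by (rule PB_Frobenius_form_if_PB_ranking[OF fin _ r']) (rule closed)
qed

end
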